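(* Every edge-coloured graph $G$ satisfies $t(C_6^A,G)\leq (1/2)^6$.
   Context: An edge-coloured graph is a (finite, simple) graph each of whose edges is coloured either red or blue. For $k\geq 2$, the alternating cycle $C_{2k}^A$ is the edge-coloured graph consisting of the cycle $C_{2k}$ in which every vertex is incident to exactly one red edge and exactly one blue edge. A homomorphism from an edge-coloured graph $H$ to an edge-coloured graph $G$ is a map $f:V(H)\to V(G)$ such that whenever $uv$ is an edge of $H$, $f(u)f(v)$ is an edge of $G$ of the same colour as $uv$. Let $\hom(H,G)$ denote the number of homomorphisms from $H$ to $G$, and define the homomorphism density $t(H,G)=\hom(H,G)/v(G)^{v(H)}$, where $v(\cdot)$ denotes the number of vertices. *)

theory Defs
  imports Complex_Main "HOL-Library.FuncSet"
begin

datatype colour = Red | Blue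

text \<open>Edges are two-element vertex sets. The value of \<open>ecg_colour\<close> at a set that is not an edge is irrelevant.\<close>

record 'a ecgraph =
  ecg_verts :: "'a set"
  ecg_edges :: "'a set set"
  ecg_colour :: "'a set \<Rightarrow> colour"

definition edge_coloured_graph :: "'a ecgraph \<Rightarrow> bool" where
  "edge_coloured_graph G \<longleftrightarrow>
     finite (ecg_verts G) \<and> (\<forall>e\<in>ecg_edges G. e \<subseteq> ecg_verts G \<and> card e = 2)"

definition ecg_hom :: "('b \<Rightarrow> 'a) \<Rightarrow> 'b ecgraph \<Rightarrow> 'a ecgraph \<Rightarrow> bool" where
  "ecg_hom f H G \<longleftrightarrow>
     f ` ecg_verts H \<subseteq> ecg_verts G \<and>
     (\<forall>u v. {u, v} \<in> ecg_edges H \<longrightarrow>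
        {f u, f v} \<in> ecg_edges G \<and> ecg_colour G {f u, f v} = ecg_colour H {u, v})"

text \<open>Maps \<open>V(H) \<rightarrow> V(G)\<close> are total functions of the logic; restricting to those that are
  extensional on \<open>V(H)\<close> counts each map exactly once.\<close>

definition hom_count :: "'b ecgraph \<Rightarrow> 'a ecgraph \<Rightarrow> nat" where
  "hom_count H G = card {f \<in> extensional (ecg_verts H). ecg_hom f H G}"

text \<open>If \<open>G\<close> has no vertices and \<open>H\<close> has some, the quotient below is \<open>0 / 0 = 0\<close>.\<close>

definition hom_density :: "'b ecgraph \<Rightarrow> 'a ecgraph \<Rightarrow> real" where
  "hom_density H G =
     real (hom_count H G) / real (card (ecg_verts G)) ^ card (ecg_verts H)"

text \<open>\<open>alt_cycle k\<close> has \<open>2k\<close> vertices and is meant for \<open>k \<ge> 2\<close>. The edges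
  \<open>{2i, 2i+1}\<close> are red, the remaining ones are blue.\<close>

definition alt_cycle :: "nat \<Rightarrow> nat ecgraph" where
  "alt_cycle k =
     \<lparr> ecg_verts = {..<2 * k},
       ecg_edges = {{i, (i + 1) mod (2 * k)} | i. i < 2 * k},
       ecg_colour = (\<lambda>e. if \<exists>i<k. e = {2 * i, 2 * i + 1} then Red else Blue) \<rparr>"

lemma edge_coloured_graph_alt_cycle:
  assumes "k \<ge> 2"
  shows "edge_coloured_graph (alt_cycle k)"
proof -
  have "i \<noteq> (i + 1) mod (2 * k)" if "i < 2 * k" for i
    using that assms by (cases "i + 1 = 2 * k") auto
  then show ?thesis
    using assms unfolding edge_coloured_graph_def alt_cycle_def
    by (auto simp: card_insert_if)
qed

lemma alt_cycle_alternating: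
  assumes k: "k \<ge> 2" and v: "v \<in> ecg_verts (alt_cycle k)"
  shows "\<exists>!e. e \<in> ecg_edges (alt_cycle k) \<and> v \<in> e \<and> ecg_colour (alt_cycle k) e = c"
proof -
  let ?E = "ecg_edges (alt_cycle k)"
  define nxt where "nxt = (\<lambda>i. (i + 1) mod (2 * k))"
  define prv where "prv = (if v = 0 then 2 * k - 1 else v - 1)"
  have v2: "v < 2 * k" using v by (simp add: alt_cycle_def)
  have nxt: "nxt i = (if i + 1 = 2 * k then 0 else i + 1)" if "i < 2 * k" for i
    using that by (auto simp: nxt_def)
  have prv: "prv < 2 * k" "nxt prv = v" using v2 k by (auto simp: prv_def nxt_def)
  have uniq: "i = prv" if "i < 2 * k" "nxt i = v" for i
    using that by (auto simp: prv_def nxt split: if_splits)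
  have E: "?E = {{i, nxt i} | i. i < 2 * k}" by (simp add: alt_cycle_def nxt_def)
  have inc: "e \<in> ?E \<and> v \<in> e \<longleftrightarrow> e = {v, nxt v} \<or> e = {prv, nxt prv}" for e
    using uniq v2 prv unfolding E by blast
  have col: "ecg_colour (alt_cycle k) {i, nxt i} = (if even i then Red else Blue)"
    if i: "i < 2 * k" for i
  proof (cases "even i")
    case True
    then obtain j where "i = 2 * j" by blast
    then have "j < k" "{i, nxt i} = {2 * j, 2 * j + 1}" using i by (auto simp: nxt)
    then have "\<exists>j<k. {i, nxt i} = {2 * j, 2 * j + 1}" by blast
    then show ?thesis using True by (simp add: alt_cycle_def)
  next
    case False
    have "{i, nxt i} \<noteq> {2 * j, 2 * j + 1}" for j
    proof
      assume "{i, nxt i} = {2 * j, 2 * j + 1}"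
      then have "i = 2 * j + 1" "nxt i = 2 * j"
        using False by (auto simp: doubleton_eq_iff)
      then show False using i k by (auto simp: nxt split: if_splits)
    qed
    then show ?thesis using False by (simp add: alt_cycle_def)
  qed
  have par: "even prv \<longleftrightarrow> odd v" using v2 by (auto simp: prv_def)
  have c: "ecg_colour (alt_cycle k) {v, nxt v} = c \<longleftrightarrow> (c = Red) = even v"
    "ecg_colour (alt_cycle k) {prv, nxt prv} = c \<longleftrightarrow> (c = Red) \<noteq> even v"
    using col[OF v2] col[OF prv(1)] par by (cases c; simp)+
  have "(e \<in> ?E \<and> v \<in> e \<and> ecg_colour (alt_cycle k) e = c) \<longleftrightarrow>
      e = (if (c = Red) = even v then {v, nxt v} else {prv, nxt prv})" for e
    using inc[of e] c by metis
  then show ?thesis by simp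
qed

end

theory Submission
  imports Defs
begin

text \<open>Let \<open>S\<close> be \<open>1\<close> on red edges and \<open>-1\<close> elsewhere, regarded as a self-adjoint operator for the
  uniform probability on the vertices. Blue edges being non-red, \<open>64 t\<close> is at most the trace of
  \<open>P\<^sup>3\<close>, where \<open>P = (J + S)(J - S)\<close> and \<open>J\<close> is the projection to the constants. With the moments
  \<open>d, a, b, c\<close> given by \<open>\<langle>1, S\<^sup>k 1\<rangle>\<close> for \<open>k = 1, 2, 3, 4\<close>, this trace is
  \<open>1 - 6a + 6c + 3a\<^sup>2 + 3d\<^sup>2 - 6db - tr S\<^sup>6\<close>. As the Hilbert-Schmidt norm of \<open>S\<close> is at most \<open>1\<close>, the
  form \<open>I - S\<^sup>2\<close> is positive semidefinite, so Cauchy-Schwarz gives \<open>(d - b)\<^sup>2 \<le> (1 - a)(a - c)\<close>.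
  The same norm bound gives \<open>2\<bar>Se\<bar>\<^sup>2 - \<langle>e, Se\<rangle>\<^sup>2 \<le> 1\<close> for the unit vector \<open>e\<close> along \<open>S1\<close>, that is,
  \<open>2ac \<le> a\<^sup>2 + b\<^sup>2\<close>. Together these bound the trace by \<open>1\<close>.\<close>

section \<open>Averages over a finite set and Cauchy-Schwarz\<close>

definition avg :: "'a set \<Rightarrow> ('a \<Rightarrow> real) \<Rightarrow> real" where
  "avg V f = (\<Sum>x\<in>V. f x) / real (card V)"

lemma avg_add: "avg V (\<lambda>x. f x + g x) = avg V f + avg V g"
  by (simp add: avg_def sum.distrib add_divide_distrib)

lemma avg_diff: "avg V (\<lambda>x. f x - g x) = avg V f - avg V g"
  by (simp add: avg_def sum_subtractf diff_divide_distrib)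

lemma avg_cmult: "avg V (\<lambda>x. c * f x) = c * avg V f"
  by (simp add: avg_def sum_distrib_left)

lemma avg_multc: "avg V (\<lambda>x. f x * c) = avg V f * c"
  by (simp add: avg_def sum_distrib_right)

lemma avg_cmult_left: "avg V (\<lambda>x. f x * (c * g x)) = c * avg V (\<lambda>x. f x * g x)"
  using avg_cmult[of V c "\<lambda>x. f x * g x"] by (simp add: mult.left_commute)

lemma avg_const: "finite V \<Longrightarrow> V \<noteq> {} \<Longrightarrow> avg V (\<lambda>x. c) = c"
  by (simp add: avg_def)

lemma avg_swap: "avg V (\<lambda>x. avg V (f x)) = avg V (\<lambda>y. avg V (\<lambda>x. f x y))"
  using sum.swap[of f V V] by (simp add: avg_def sum_divide_distrib[symmetric])

lemma avg_mono: "(\<And>x. x \<in> V \<Longrightarrow> f x \<le> g x) \<Longrightarrow> avg V f \<le> avg V g"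
  by (simp add: avg_def divide_right_mono sum_mono)

lemma avg_nonneg: "(\<And>x. x \<in> V \<Longrightarrow> 0 \<le> f x) \<Longrightarrow> 0 \<le> avg V f"
  by (simp add: avg_def sum_nonneg)

lemmas avg_linear = avg_add avg_diff avg_cmult avg_multc avg_cmult_left

text \<open>Evaluating the form at \<open>(- C, A)\<close> or \<open>(B, - C)\<close> gives
  \<open>A * B - C^2\<close> times the coefficient \<open>A\<close> or \<open>B\<close>, which can
  be cancelled if positive.\<close>

lemma discriminant_le:
  fixes A B C :: real
  assumes nonneg: "\<And>s t. 0 \<le> s\<^sup>2 * A + 2 * s * t * C + t\<^sup>2 * B"
  shows "C\<^sup>2 \<le> A * B"
proof -
  have A: "0 \<le> A" and B: "0 \<le> B" using nonneg[of 1 0] nonneg[of 0 1] by auto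
  consider "A > 0" | "B > 0" | "A = 0" "B = 0" using A B by linarith
  then show ?thesis
  proof cases
    case 1
    have "0 \<le> A * (A * B - C\<^sup>2)"
      using nonneg[of "- C" A] by (simp add: power2_eq_square algebra_simps)
    then show ?thesis using 1 by (simp add: zero_le_mult_iff)
  next
    case 2
    have "0 \<le> B * (A * B - C\<^sup>2)"
      using nonneg[of B "- C"] by (simp add: power2_eq_square algebra_simps)
    then show ?thesis using 2 by (simp add: zero_le_mult_iff)
  next
    case 3
    \<comment> \<open>Only the cross term is left here: at \<open>(1, - C)\<close> it equals
      \<open>- 2 * C^2\<close>, which forces \<open>C = 0\<close>.\<close>
    then show ?thesis using nonneg[of 1 "- C"] by (simp add: power2_eq_square)
  qed
qed

lemma avg_cauchy_schwarz:
  "(avg V (\<lambda>x. f x * g x))\<^sup>2 \<le> avg V (\<lambda>x. (f x)\<^sup>2) * avg V (\<lambda>x. (g x)\<^sup>2)"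
proof (rule discriminant_le)
  fix s t :: real
  have "0 \<le> avg V (\<lambda>x. (s * f x + t * g x)\<^sup>2)" by (rule avg_nonneg) simp
  also have "(\<lambda>x. (s * f x + t * g x)\<^sup>2)
      = (\<lambda>x. s\<^sup>2 * (f x)\<^sup>2 + (2 * s * t) * (f x * g x) + t\<^sup>2 * (g x)\<^sup>2)"
    by (simp add: fun_eq_iff power2_eq_square algebra_simps)
  finally show "0 \<le> s\<^sup>2 * avg V (\<lambda>x. (f x)\<^sup>2) + 2 * s * t * avg V (\<lambda>x. f x * g x)
      + t\<^sup>2 * avg V (\<lambda>x. (g x)\<^sup>2)"
    by (simp only: avg_add avg_cmult)
qed

section \<open>The operator of a bounded symmetric kernel and its moments\<close>

locale sign_kernel =
  fixes V :: "'a set" and S :: "'a \<Rightarrow> 'a \<Rightarrow> real"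
  assumes fin: "finite V" and nonempty: "V \<noteq> {}"
    and sym: "S x y = S y x" and bound: "\<bar>S x y\<bar> \<le> 1"
begin

abbreviation E :: "('a \<Rightarrow> real) \<Rightarrow> real" where "E \<equiv> avg V"

definition op :: "('a \<Rightarrow> real) \<Rightarrow> 'a \<Rightarrow> real" where
  "op f x = E (\<lambda>y. S x y * f y)"

definition u where "u = op (\<lambda>_. 1)"
definition w where "w = op u"
definition g where "g = op w"
text \<open>The kernel of the square of \<open>op\<close>.\<close>

definition T where "T x z = E (\<lambda>y. S x y * S y z)"
definition d where "d = E u"
definition a where "a = E (\<lambda>x. u x * u x)"
definition b where "b = E (\<lambda>x. u x * w x)"
definition c where "c = E (\<lambda>x. w x * w x)"

lemma E_const: "E (\<lambda>x. k) = k"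
  by (rule avg_const[OF fin nonempty])

lemma op_self_adjoint: "E (\<lambda>x. op f x * h x) = E (\<lambda>x. f x * op h x)"
proof -
  have "E (\<lambda>x. op f x * h x) = E (\<lambda>x. E (\<lambda>y. S x y * f y * h x))"
    by (simp add: op_def avg_multc)
  also have "\<dots> = E (\<lambda>y. E (\<lambda>x. S x y * f y * h x))"
    by (rule avg_swap)
  also have "\<dots> = E (\<lambda>y. E (\<lambda>x. f y * (S y x * h x)))"
    by (simp add: sym mult_ac)
  also have "\<dots> = E (\<lambda>y. f y * op h y)"
    by (simp add: op_def avg_cmult)
  finally show ?thesis .
qed

lemma T_sym: "T x y = T y x"
  unfolding T_def by (subst (1 2) sym) (simp add: mult.commute)

lemma E_T: "E (\<lambda>y. T x y * f y) = op (op f) x"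
proof -
  have "E (\<lambda>y. T x y * f y) = E (\<lambda>y. E (\<lambda>z. S x z * S z y * f y))"
    by (simp add: T_def avg_multc)
  also have "\<dots> = E (\<lambda>z. E (\<lambda>y. S x z * S z y * f y))"
    by (rule avg_swap)
  also have "\<dots> = op (op f) x"
    by (simp add: op_def avg_cmult mult.assoc)
  finally show ?thesis .
qed

lemma S_sq_le: "(S x y)\<^sup>2 \<le> 1"
  using bound[of x y] by (simp add: abs_square_le_1)

text \<open>Cauchy-Schwarz in each row suffices, since every row of \<open>S\<close> has mean square
  at most \<open>1\<close>.\<close>

lemma op_contraction: "E (\<lambda>x. (op f x)\<^sup>2) \<le> E (\<lambda>x. (f x)\<^sup>2)"
proof -
  have "(op f x)\<^sup>2 \<le> E (\<lambda>x. (f x)\<^sup>2)" for x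
  proof -
    have "(op f x)\<^sup>2 \<le> E (\<lambda>y. (S x y)\<^sup>2) * E (\<lambda>y. (f y)\<^sup>2)"
      unfolding op_def by (rule avg_cauchy_schwarz)
    also have "\<dots> \<le> 1 * E (\<lambda>y. (f y)\<^sup>2)"
      using avg_mono[of V "\<lambda>y. (S x y)\<^sup>2" "\<lambda>y. 1"] S_sq_le
      by (intro mult_right_mono avg_nonneg) (auto simp: E_const)
    finally show ?thesis by simp
  qed
  then have "E (\<lambda>x. (op f x)\<^sup>2) \<le> E (\<lambda>x. E (\<lambda>x. (f x)\<^sup>2))"
    by (intro avg_mono)
  then show ?thesis by (simp add: E_const)
qed

lemma a_le_1: "a \<le> 1"
  using op_contraction[of "\<lambda>_. 1"] by (simp add: a_def u_def E_const power2_eq_square)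

lemma c_le_a: "c \<le> a"
  using op_contraction[of u] by (simp add: a_def c_def w_def power2_eq_square)

text \<open>The contraction inequality for all combinations of \<open>1\<close> and \<open>u\<close>
  says that a binary quadratic form with coefficients \<open>1 - a\<close>, \<open>d - b\<close> and
  \<open>a - c\<close> is nonnegative.\<close>

lemma d_minus_b_sq: "(d - b)\<^sup>2 \<le> (1 - a) * (a - c)"
proof (rule discriminant_le)
  fix s t :: real
  have "op (\<lambda>x. s + t * u x) = (\<lambda>x. s * u x + t * w x)"
    unfolding u_def w_def
    by (simp add: fun_eq_iff op_def algebra_simps avg_linear)
  moreover have "E (\<lambda>x. (s * u x + t * w x)\<^sup>2) = s\<^sup>2 * a + 2 * s * t * b + t\<^sup>2 * c"
    unfolding a_def b_def c_def avg_cmult[symmetric] avg_add[symmetric]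
    by (rule arg_cong[where f = E]) (simp add: fun_eq_iff power2_eq_square algebra_simps)
  moreover have "E (\<lambda>x. (s + t * u x)\<^sup>2) = s\<^sup>2 + 2 * s * t * d + t\<^sup>2 * a"
    unfolding a_def d_def avg_cmult[symmetric]
    by (subst (1) E_const[symmetric], unfold avg_add[symmetric], rule arg_cong[where f = E])
      (simp add: fun_eq_iff power2_eq_square algebra_simps)
  ultimately show "0 \<le> s\<^sup>2 * (1 - a) + 2 * s * t * (d - b) + t\<^sup>2 * (a - c)"
    using op_contraction[of "\<lambda>x. s + t * u x"] by (simp add: algebra_simps)
qed

text \<open>Subtracts from \<open>S\<close> its blocks meeting the direction \<open>u\<close>; the remaining
  Hilbert-Schmidt norm is nonnegative.\<close>

lemma two_a_c_le: "2 * a * c \<le> a\<^sup>2 + b\<^sup>2"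
proof (cases "a = 0")
  case True
  then show ?thesis by simp
next
  case False
  define H where "H = E (\<lambda>x. E (\<lambda>y. S x y * S x y))"
  have H: "H \<le> 1"
  proof -
    have "H \<le> E (\<lambda>x. E (\<lambda>y. 1))"
      unfolding H_def using S_sq_le by (intro avg_mono) (simp add: power2_eq_square)
    then show ?thesis by (simp add: E_const)
  qed
  \<comment> \<open>With \<open>Q\<close> the projection orthogonal to \<open>u\<close>, the squared
    expression is the kernel of \<open>Q S Q\<close> multiplied by \<open>a^2\<close>, which clears
    the denominators. In the expansion the factors depending on \<open>y\<close> are grouped so that
    the averages can be taken one variable at a time.\<close>
  have sq: "(a\<^sup>2 * S x y - a * (u x * w y + w x * u y) + b * (u x * u y))\<^sup>2 =
      a^4 * (S x y * S x y) + a\<^sup>2 * ((u x * u x) * (w y * w y)) + a\<^sup>2 * ((w x * w x) * (u y * u y))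
      + 2 * a\<^sup>2 * ((u x * w x) * (u y * w y)) + b\<^sup>2 * ((u x * u x) * (u y * u y))
      - 2 * a^3 * (u x * (S x y * w y)) - 2 * a^3 * (w x * (S x y * u y))
      + 2 * a\<^sup>2 * b * (u x * (S x y * u y))
      - 2 * a * b * ((u x * u x) * (u y * w y)) - 2 * a * b * ((u x * w x) * (u y * u y))" for x y
    by (simp add: power2_eq_square power3_eq_cube power4_eq_xxxx algebra_simps)
  have uSw: "E (\<lambda>x. u x * g x) = c"
    unfolding g_def op_self_adjoint[symmetric] by (simp add: c_def w_def)
  have "0 \<le> E (\<lambda>x. E (\<lambda>y. (a\<^sup>2 * S x y - a * (u x * w y + w x * u y) + b * (u x * u y))\<^sup>2))"
    by (intro avg_nonneg) simp
  also have "\<dots> = a^4 * H + a\<^sup>2 * (a * c) + a\<^sup>2 * (c * a) + 2 * a\<^sup>2 * (b * b) + b\<^sup>2 * (a * a)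
      - 2 * a^3 * c - 2 * a^3 * c + 2 * a\<^sup>2 * b * b - 2 * a * b * (a * b) - 2 * a * b * (b * a)"
    unfolding sq avg_add avg_diff avg_cmult avg_multc
    unfolding H_def[symmetric] unfolding op_def[symmetric]
    unfolding a_def[symmetric] b_def[symmetric] c_def[symmetric] w_def[symmetric] g_def[symmetric] uSw avg_multc
    by (simp add: c_def[symmetric] a_def[symmetric] b_def[symmetric])
  also have "\<dots> = a\<^sup>2 * (a\<^sup>2 * H + b\<^sup>2 - 2 * a * c)"
    by (simp add: power2_eq_square power3_eq_cube power4_eq_xxxx algebra_simps)
  finally have "0 \<le> a\<^sup>2 * H + b\<^sup>2 - 2 * a * c"
    using False by (simp add: zero_le_mult_iff)
  moreover have "a\<^sup>2 * H \<le> a\<^sup>2" using H by (simp add: mult_left_le)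
  ultimately show ?thesis by linarith
qed

section \<open>Traces of products of kernels\<close>

definition TT where "TT x z = E (\<lambda>y. T x y * T y z)"
text \<open>The trace of the cube of \<open>T\<close>, hence of the sixth power of
  \<open>op\<close>.\<close>

definition tr3 where "tr3 = E (\<lambda>x. E (\<lambda>y. T x y * TT y x))"

text \<open>By symmetry, the trace of \<open>S^6\<close> is the squared Hilbert-Schmidt norm of
  \<open>S^3\<close>, whose kernel is the average of \<open>T x y * S y v\<close> over
  \<open>y\<close>.\<close>

lemma tr3_nonneg: "0 \<le> tr3"
proof -
  have "E (\<lambda>y. T x y * TT y x) = E (\<lambda>v. (E (\<lambda>y. T x y * S y v))\<^sup>2)" for x
  proof -
    \<comment> \<open>The fourth power is split as \<open>S\<close> times the cube, so that the cube
      appears twice below.\<close>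
    have "TT y x = E (\<lambda>v. S y v * E (\<lambda>z. T x z * S z v))" for y
    proof -
      have "TT y x = op (op (\<lambda>z. T z x)) y" unfolding TT_def by (rule E_T)
      then show ?thesis by (simp add: op_def T_sym[of x] sym mult.commute)
    qed
    then have "E (\<lambda>y. T x y * TT y x) = E (\<lambda>y. E (\<lambda>v. T x y * S y v * E (\<lambda>z. T x z * S z v)))"
      by (simp add: avg_cmult[symmetric] mult.assoc)
    also have "\<dots> = E (\<lambda>v. E (\<lambda>y. T x y * S y v * E (\<lambda>z. T x z * S z v)))"
      by (rule avg_swap)
    also have "\<dots> = E (\<lambda>v. (E (\<lambda>y. T x y * S y v))\<^sup>2)"
      by (simp add: avg_multc power2_eq_square)
    finally show ?thesis .
  qed
  then show ?thesis unfolding tr3_def by (simp add: avg_nonneg)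
qed

text \<open>For \<open>S\<close> equal to \<open>1\<close> on red pairs and \<open>-1\<close>
  elsewhere, this is four times the proportion of \<open>y\<close> with \<open>x y\<close> red and
  \<open>y z\<close> not red.\<close>

definition P where "P x z = E (\<lambda>y. (1 + S x y) * (1 - S y z))"

lemma P_eq: "P x z = 1 + u x - u z - T x z"
proof -
  have "E (\<lambda>y. S y z) = u z" by (simp add: u_def op_def sym[of _ z])
  moreover have "E (\<lambda>y. S x y) = u x" by (simp add: u_def op_def)
  ultimately show ?thesis
    unfolding P_def T_def by (simp add: algebra_simps avg_linear E_const)
qed

lemma E_T': "E (\<lambda>y. f y * T x y) = op (op f) x" "E (\<lambda>y. f y * T y x) = op (op f) x"
  "E (\<lambda>y. T x y) = w x" "E (\<lambda>y. T y x) = w x"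
  using E_T[of x f] E_T[of x "\<lambda>_. 1"] by (simp_all add: mult.commute T_sym[of _ x] u_def w_def)

lemma E_TT: "E (\<lambda>y. f y * TT y x) = op (op (op (op f))) x" "E (\<lambda>y. TT y x) = op (op w) x"
proof -
  have *: "E (\<lambda>y. f y * TT y x) = op (op (op (op f))) x" for f
  proof -
    have "TT y x = op (op (\<lambda>z. T z x)) y" for y unfolding TT_def by (rule E_T)
    then have "E (\<lambda>y. f y * TT y x) = E (\<lambda>z. op (op f) z * T z x)"
      by (simp add: op_self_adjoint)
    then show ?thesis by (simp add: E_T')
  qed
  then show "E (\<lambda>y. f y * TT y x) = op (op (op (op f))) x" .
  show "E (\<lambda>y. TT y x) = op (op w) x" using *[of "\<lambda>_. 1"] by (simp add: u_def w_def)
qed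

lemma ops: "op u = w" "op w = g" by (simp_all add: w_def g_def)

lemma PP_eq: "E (\<lambda>z. P y z * P z x) = (1 + u y) * (1 - u x) + (1 + u y) * (d - w x) - (1 - u x) * (d + w y)
    - a + g x - g y + TT y x"
proof -
  have "P y z * P z x = (1 + u y) * (1 - u x) + (1 + u y) * u z - (1 + u y) * T z x
     - (1 - u x) * u z - u z * u z + u z * T z x - (1 - u x) * T y z - T y z * u z + T y z * T z x" for z
    by (simp add: P_eq algebra_simps)
  then show ?thesis
    unfolding TT_def
    by (simp only: avg_add avg_diff avg_cmult E_const)
      (simp add: E_T' E_T[of _ u] ops d_def[symmetric] a_def[symmetric] algebra_simps)
qed

text \<open>Self-adjointness moves powers of \<open>S\<close> from one factor to the other, so each
  average depends only on the total power.\<close>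

lemma E_moments: "E w = a" "E g = b" "E (\<lambda>x. u x * g x) = c" "E (op g) = c" "E (op (op g)) = E (\<lambda>x. w x * g x)"
  "E (\<lambda>x. u x * op g x) = E (\<lambda>x. w x * g x)"
proof -
  have *: "E (op f) = E (\<lambda>x. u x * f x)" for f
    using op_self_adjoint[of f "\<lambda>_. 1"] by (simp add: u_def mult.commute)
  have **: "E (\<lambda>x. u x * op f x) = E (\<lambda>x. w x * f x)" for f
    using op_self_adjoint[of u f] by (simp add: w_def)
  show "E w = a" "E g = b" "E (\<lambda>x. u x * g x) = c" "E (op g) = c" "E (op (op g)) = E (\<lambda>x. w x * g x)"
  "E (\<lambda>x. u x * op g x) = E (\<lambda>x. w x * g x)"
    using *[of u] *[of w] **[of w] *[of g] *[of "op g"] **[of g]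
    by (simp_all add: ops a_def b_def c_def)
qed

text \<open>By cyclicity the trace is unchanged when \<open>S\<close> becomes \<open>- S\<close>, so
  only terms of even total degree in \<open>S\<close> survive; in particular the fifth moment,
  \<open>e\<close> below, cancels.\<close>

lemma trace_P: "E (\<lambda>x. E (\<lambda>y. P x y * E (\<lambda>z. P y z * P z x)))
    = 1 - 6 * a + 6 * c + 3 * a\<^sup>2 + 3 * d\<^sup>2 - 6 * d * b - tr3"
proof -
  define h where "h = op g"
  define k where "k = op h"
  define e where "e = E (\<lambda>x. w x * g x)"
  define A where "A x = 1 + u x" for x
  define B where "B x = 1 - u x" for x
  \<comment> \<open>For fixed \<open>x\<close>, \<open>PP_eq\<close> has the coefficients
    \<open>K x\<close>, \<open>L x\<close> and \<open>- B x\<close> at \<open>1\<close>,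
    \<open>u y\<close> and \<open>w y\<close>; similarly \<open>P x y\<close> is
    \<open>A x - u y - T x y\<close>.\<close>
  define L where "L x = B x + d - w x" for x
  define K where "K x = L x - d * B x - a + g x" for x
  have inner: "E (\<lambda>y. P x y * E (\<lambda>z. P y z * P z x)) =
      A x * (K x + L x * d - B x * a - b + h x) - (K x * d + L x * a - B x * b - c + k x)
      - (K x * w x + L x * g x - B x * h x - k x + E (\<lambda>y. T x y * TT y x))" for x
  proof -
    have "P x y * E (\<lambda>z. P y z * P z x) =
        A x * K x + (A x * L x) * u y - (A x * B x) * w y - A x * g y + A x * TT y x
        - K x * u y - L x * (u y * u y) + B x * (u y * w y) + u y * g y - u y * TT y x
        - K x * T x y - L x * (T x y * u y) + B x * (T x y * w y) + T x y * g y - T x y * TT y x" for y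
      unfolding PP_eq unfolding P_eq A_def K_def L_def B_def by (simp add: algebra_simps)
    then show ?thesis
      by (simp only: avg_add avg_diff avg_cmult E_const E_T'(3) E_T[of _ u] E_T[of _ w] E_T[of _ g]
          E_TT ops E_moments d_def[symmetric] a_def[symmetric] b_def[symmetric]
          h_def[symmetric] k_def[symmetric])
        (simp add: algebra_simps)
  qed
  have m: "E u = d" "E (\<lambda>x. u x * u x) = a" "E (\<lambda>x. u x * w x) = b" "E (\<lambda>x. w x * u x) = b"
    "E (\<lambda>x. w x * w x) = c" "E (\<lambda>x. u x * g x) = c" "E (\<lambda>x. g x * u x) = c"
    "E h = c" "E k = e" "E (\<lambda>x. u x * h x) = e" "E (\<lambda>x. h x * u x) = e"
    "E (\<lambda>x. w x * g x) = e" "E (\<lambda>x. g x * w x) = e"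
    using E_moments
    by (simp_all add: a_def b_def c_def d_def e_def h_def k_def mult.commute)
  show ?thesis
    unfolding inner K_def L_def A_def B_def
    by (simp add: algebra_simps avg_linear E_const m E_moments(1,2) tr3_def[symmetric] power2_eq_square)
qed

lemma trace_P_le: "E (\<lambda>x. E (\<lambda>y. P x y * E (\<lambda>z. P y z * P z x))) \<le> 1"
proof -
  have "0 \<le> (1 - a) * (a - c)" using a_le_1 c_le_a by simp
  \<comment> \<open>Completing the square turns \<open>d^2 - 2 * d * b\<close> into
    \<open>(d - b)^2 - b^2\<close>. Inserting the bounds on \<open>(d - b)^2\<close> and
    \<open>2 * a * c\<close> makes the left side at most
    \<open>-3 * (1 - a) * (a - c)\<close>.\<close>
  then have "6 * (c - a) + 3 * a\<^sup>2 + 3 * (d - b)\<^sup>2 - 3 * b\<^sup>2 \<le> 0"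
    using d_minus_b_sq two_a_c_le by (simp add: power2_eq_square algebra_simps)
  then show ?thesis
    unfolding trace_P using tr3_nonneg by (simp add: power2_eq_square algebra_simps)
qed

end

section \<open>Counting homomorphisms by a weighted cyclic sum\<close>

text \<open>Summing out \<open>x5\<close>, \<open>x3\<close> and \<open>x1\<close> merges each pair
  of consecutive weights into one kernel and leaves the trace of its cube.\<close>

lemma avg_cyclic_product:
  fixes p q :: "'a \<Rightarrow> 'a \<Rightarrow> real" and V :: "'a set"
  shows "(\<Sum>(x0,x1,x2,x3,x4,x5)\<in>V \<times> V \<times> V \<times> V \<times> V \<times> V.
      p x0 x1 * q x1 x2 * (p x2 x3 * q x3 x4) * (p x4 x5 * q x5 x0)) / real (card V) ^ 6
    = avg V (\<lambda>x0. avg V (\<lambda>x2. avg V (\<lambda>y. p x0 y * q y x2) *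
        avg V (\<lambda>x4. avg V (\<lambda>y. p x2 y * q y x4) * avg V (\<lambda>y. p x4 y * q y x0))))"
proof -
  let ?n = "real (card V)"
  define F where "F x z = (\<Sum>y\<in>V. p x y * q y z)" for x z
  have "(\<Sum>(x0,x1,x2,x3,x4,x5)\<in>V \<times> V \<times> V \<times> V \<times> V \<times> V.
      p x0 x1 * q x1 x2 * (p x2 x3 * q x3 x4) * (p x4 x5 * q x5 x0))
    = (\<Sum>x0\<in>V. \<Sum>x1\<in>V. \<Sum>x2\<in>V. \<Sum>x3\<in>V. \<Sum>x4\<in>V. \<Sum>x5\<in>V.
      p x0 x1 * q x1 x2 * (p x2 x3 * q x3 x4) * (p x4 x5 * q x5 x0))"
    by (simp add: sum.cartesian_product split_def)
  also have "\<dots> = (\<Sum>x0\<in>V. \<Sum>x1\<in>V. \<Sum>x2\<in>V. \<Sum>x3\<in>V. \<Sum>x4\<in>V.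
      p x0 x1 * q x1 x2 * (p x2 x3 * q x3 x4) * F x4 x0)"
    by (simp add: F_def sum_distrib_left)
  also have "\<dots> = (\<Sum>x0\<in>V. \<Sum>x1\<in>V. \<Sum>x2\<in>V. \<Sum>x4\<in>V. \<Sum>x3\<in>V.
      p x0 x1 * q x1 x2 * (p x2 x3 * q x3 x4) * F x4 x0)"
    by (intro sum.cong refl sum.swap)
  also have "\<dots> = (\<Sum>x0\<in>V. \<Sum>x1\<in>V. \<Sum>x2\<in>V. p x0 x1 * q x1 x2 * (\<Sum>x4\<in>V. (\<Sum>x3\<in>V. p x2 x3 * q x3 x4) * F x4 x0))"
    by (simp add: sum_distrib_left sum_distrib_right mult.assoc)
  also have "\<dots> = (\<Sum>x0\<in>V. \<Sum>x2\<in>V. \<Sum>x1\<in>V. p x0 x1 * q x1 x2 * (\<Sum>x4\<in>V. F x2 x4 * F x4 x0))"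
    unfolding F_def[symmetric] by (intro sum.cong refl sum.swap)
  also have "\<dots> = (\<Sum>x0\<in>V. \<Sum>x2\<in>V. F x0 x2 * (\<Sum>x4\<in>V. F x2 x4 * F x4 x0))"
    by (simp add: F_def[symmetric] sum_distrib_right[symmetric])
  finally show ?thesis
    by (simp add: avg_def F_def[symmetric] sum_divide_distrib[symmetric] power_numeral_reduce mult_ac)
qed

lemma ecg_hom_alt_cycle_3:
  assumes "ecg_hom f (alt_cycle 3) G"
  shows "\<And>i. i < 6 \<Longrightarrow> f i \<in> ecg_verts G"
    and "{f 0, f 1} \<in> ecg_edges G \<and> ecg_colour G {f 0, f 1} = Red"
    and "{f 1, f 2} \<in> ecg_edges G \<and> ecg_colour G {f 1, f 2} = Blue"
    and "{f 2, f 3} \<in> ecg_edges G \<and> ecg_colour G {f 2, f 3} = Red"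
    and "{f 3, f 4} \<in> ecg_edges G \<and> ecg_colour G {f 3, f 4} = Blue"
    and "{f 4, f 5} \<in> ecg_edges G \<and> ecg_colour G {f 4, f 5} = Red"
    and "{f 5, f 0} \<in> ecg_edges G \<and> ecg_colour G {f 5, f 0} = Blue"
proof -
  show "f i \<in> ecg_verts G" if "i < 6" for i
    using assms that by (auto simp: ecg_hom_def alt_cycle_def)
  have edge: "{f i, f j} \<in> ecg_edges G \<and> ecg_colour G {f i, f j} = ecg_colour (alt_cycle 3) {i, j}"
    if "i < 6" "j = (i + 1) mod 6" for i j
  proof -
    have "{i, j} \<in> ecg_edges (alt_cycle 3)" using that by (auto simp: alt_cycle_def)
    then show ?thesis using assms unfolding ecg_hom_def by blast
  qed
  have ex3: "(\<exists>i<3. Q i) \<longleftrightarrow> Q 0 \<or> Q 1 \<or> Q 2" for Q :: "nat \<Rightarrow> bool"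
    by (simp add: numeral_eq_Suc less_Suc_eq ex_disj_distrib conj_disj_distribR)
  have col: "ecg_colour (alt_cycle 3) {0, 1} = Red" "ecg_colour (alt_cycle 3) {1, 2} = Blue"
    "ecg_colour (alt_cycle 3) {2, 3} = Red" "ecg_colour (alt_cycle 3) {3, 4} = Blue"
    "ecg_colour (alt_cycle 3) {4, 5} = Red" "ecg_colour (alt_cycle 3) {5, 0} = Blue"
    by (simp_all add: alt_cycle_def ex3 doubleton_eq_iff)
  show "{f 0, f 1} \<in> ecg_edges G \<and> ecg_colour G {f 0, f 1} = Red"
    "{f 1, f 2} \<in> ecg_edges G \<and> ecg_colour G {f 1, f 2} = Blue"
    "{f 2, f 3} \<in> ecg_edges G \<and> ecg_colour G {f 2, f 3} = Red"
    "{f 3, f 4} \<in> ecg_edges G \<and> ecg_colour G {f 3, f 4} = Blue"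
    "{f 4, f 5} \<in> ecg_edges G \<and> ecg_colour G {f 4, f 5} = Red"
    "{f 5, f 0} \<in> ecg_edges G \<and> ecg_colour G {f 5, f 0} = Blue"
    using edge[of 0 1] edge[of 1 2] edge[of 2 3] edge[of 3 4] edge[of 4 5] edge[of 5 0] col
    by simp_all
qed

theorem theorem1:
  fixes G :: "'a ecgraph"
  assumes "edge_coloured_graph G"
  shows "hom_density (alt_cycle 3) G \<le> (1 / 2) ^ 6"
proof (cases "ecg_verts G = {}")
  case True
  \<comment> \<open>The denominator is \<open>0 ^ 6 = 0\<close>, so the density is
    \<open>0\<close>.\<close>
  then show ?thesis by (simp add: hom_density_def alt_cycle_def)
next
  case False
  define V where "V = ecg_verts G"
  have V: "finite V" "V \<noteq> {}" using assms False by (auto simp: edge_coloured_graph_def V_def)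
  define red where "red x y \<longleftrightarrow> {x, y} \<in> ecg_edges G \<and> ecg_colour G {x, y} = Red" for x y
  \<comment> \<open>The value is \<open>-1\<close> on non-edges and on the diagonal too, so
    \<open>1 - S\<close> is at least twice the indicator of the blue edges.\<close>
  define S where "S x y = (if red x y then 1 else - 1 :: real)" for x y
  interpret sign_kernel V S
    by unfold_locales (auto simp: V S_def red_def insert_commute)
  let ?F = "{f \<in> extensional (ecg_verts (alt_cycle 3)). ecg_hom f (alt_cycle 3) G}"
  let ?V6 = "V \<times> V \<times> V \<times> V \<times> V \<times> V"
  let ?m = "\<lambda>f :: nat \<Rightarrow> 'a. (f 0, f 1, f 2, f 3, f 4, f 5)"
  define p where "p x y = 1 + S x y" for x y
  define q where "q x y = 1 - S x y" for x y
  let ?w = "\<lambda>(x0,x1,x2,x3,x4,x5). p x0 x1 * q x1 x2 * (p x2 x3 * q x3 x4) * (p x4 x5 * q x5 x0)"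
  have nonneg: "p x y \<ge> 0" "q x y \<ge> 0" for x y by (auto simp: p_def q_def S_def)
  have inj: "inj_on ?m ?F"
  proof (rule inj_onI)
    fix f f' assume f: "f \<in> ?F" "f' \<in> ?F" "?m f = ?m f'"
    have "f i = f' i" if "i \<in> {..<6}" for i
    proof -
      have "i = 0 \<or> i = 1 \<or> i = 2 \<or> i = 3 \<or> i = 4 \<or> i = 5" using that by auto
      then show ?thesis using f(3) by auto
    qed
    then show "f = f'" using f(1,2) by (intro extensionalityI[of f "{..<6}" f']) (auto simp: alt_cycle_def)
  qed
  \<comment> \<open>Each of the six edges contributes a factor \<open>2\<close>.\<close>
  have sub: "?m f \<in> ?V6 \<and> ?w (?m f) = 64" if "f \<in> ?F" for f
  proof -
    have hom: "ecg_hom f (alt_cycle 3) G" using that by simp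
    note H = ecg_hom_alt_cycle_3[OF hom]
    have "?m f \<in> ?V6" by (simp add: V_def H(1))
    moreover have "p (f 0) (f 1) = 2" "q (f 1) (f 2) = 2" "p (f 2) (f 3) = 2"
      "q (f 3) (f 4) = 2" "p (f 4) (f 5) = 2" "q (f 5) (f 0) = 2"
      using H(2-) by (simp_all add: p_def q_def S_def red_def)
    ultimately show ?thesis by simp
  qed
  have "64 * real (card ?F) = (\<Sum>t\<in>?m ` ?F. 64)"
    using card_image[OF inj] by simp
  also have "\<dots> = (\<Sum>t\<in>?m ` ?F. ?w t)"
    using sub by (intro sum.cong) auto
  \<comment> \<open>Tuples that do not come from a homomorphism have nonnegative weight.\<close>
  also have "\<dots> \<le> (\<Sum>t\<in>?V6. ?w t)"
    using sub V nonneg by (intro sum_mono2) auto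
  finally have "64 * hom_density (alt_cycle 3) G \<le> (\<Sum>t\<in>?V6. ?w t) / real (card V) ^ 6"
    using divide_right_mono[of _ _ "real (card V) ^ 6"]
    by (simp add: hom_density_def hom_count_def V_def alt_cycle_def)
  also have "\<dots> = E (\<lambda>x. E (\<lambda>y. P x y * E (\<lambda>z. P y z * P z x)))"
    unfolding avg_cyclic_product P_def p_def q_def ..
  also have "\<dots> \<le> 1" by (rule trace_P_le)
  finally show ?thesis by (simp add: power_one_over)
qed

end
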